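(* Let $f_0$ be in $\mathbb{H}_1$, $u=(u_m)_{m\ge0}$ a positive decreasing sequence, $C$ a positive number, $r$ a nonnegative integer and $K$ a positive number such that $K\le1$. Assume that $(\Pi\mathbf{1}_k)_{k\ge0}$ is a sequence of linearly independent functions in $\mathbb{H}\cap L^1(\nu)$. Then for any positive integer $n$, any estimator $\hat f$ in $\mathcal{S}_n$ and any integer $m\ge r$, $$\sup_{f\in(f_0+\mathcal{C}_{f_0}(K,u,C,r))\cap\mathbb{H}_1}\mathbb{E}_f\|\hat f-f\|_{\mathbb{H}}^2\ \ge\ \left(\frac{K}{K_{\infty,f_0}(V_{m+2}\ominus V_m)}\wedge(Cu_{m+1})\right)^2\big(\pi_{f_0}\{0,\dots,m-1\}\big)^n .$$
   Context: $\mathcal{X}=\mathbb{Z}_+=\{0,1,2,\dots\}$, $\Theta$ is a Borel subset of $\mathbb{R}^d$, and $(\pi_\theta)_{\theta\in\Theta}$ is a family of probability mass functions on $\mathbb{Z}_+$, measurable in $\theta$. $\nu$ is a Radon measure on $\Theta$, $\mathbb{H}=L^2(\nu)$ (real) with scalar product $(f,g)_{\mathbb{H}}=\int fg\,d\nu$; $\mathbb{H}_+=\{f\in\mathbb{H}:f\ge0\}$, $\mathbb{H}_1=\{f\in\mathbb{H}_+:\int f\,d\nu=1\}$. For $k\ge0$, $\Pi\mathbf{1}_k$ is the function $\theta\mapsto\pi_\theta(k)$ on $\Theta$. $V_0=\{0\}$ and $V_m=\mathrm{Span}(\Pi\mathbf{1}_k,0\le k<m)$ for $m\ge1$; $V_{m+2}\ominus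 V_m=V_{m+2}\cap V_m^\perp$; $\mathrm{Proj}_V$ is orthogonal projection onto $V$. For $f\in\mathbb{H}_1$, $\pi_f(k)=\int\pi_\theta(k)f(\theta)\nu(d\theta)$ is the mixture distribution on $\mathbb{Z}_+$. $\mathcal{S}_n$ is the set of measurable functions $\mathcal{X}^n\to\mathbb{H}$ and $\mathbb{E}_f$ is expectation when the $n$ observations are i.i.d. from $\pi_f$. Smoothness class: $\mathcal{C}(u,C,r)=\{f\in\mathbb{H}:\|f-\mathrm{Proj}_{V_m}f\|_{\mathbb{H}}\le Cu_m\text{ for all }m\ge r\}$. For $f_0\in\mathbb{H}_+$: $\|f\|_{\infty,f_0}=\nu\text{-}\mathrm{ess\,sup}_{\theta\in\Theta}|f(\theta)|/f_0(\theta)$, possibly infinite, with $0/0=0$ and $s/0=\infty$ for $s>0$; $\mathcal{C}_{f_0}(K,u,C,r)=\{f\in\mathcal{C}(u,C,r):\|f\|_{\infty,f_0}\le K\}$; and for a subspace $V$ of $\mathbb{H}$, $K_{\infty,f_0}(V)=\sup\{\|f\|_{\infty,f_0}:f\in V,\|f\|_{\mathbb{H}}=1\}\in(0,\infty]$, with $K/\infty=0$. $a\wedge b=\min(a,b)$. *)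

theory Defs
  imports "HOL-Probability.Probability"
begin

text \<open>
  Elements of \<open>L\<^sup>2(\<nu>)\<close> are represented by square-integrable functions, and equality in
  \<open>L\<^sup>2(\<nu>)\<close> is equality \<open>\<nu>\<close>-almost everywhere. No notion below
  depends on the choice of representatives.
\<close>

definition radon_measure_on :: "'a::topological_space set \<Rightarrow> 'a measure \<Rightarrow> bool" where
  "radon_measure_on \<Theta> \<nu> \<longleftrightarrow>
     sets \<nu> = sets (restrict_space borel \<Theta>) \<and>
     (\<forall>x\<in>\<Theta>. \<exists>U. open U \<and> x \<in> U \<and> emeasure \<nu> (U \<inter> \<Theta>) < \<infinity>) \<and>
     (\<forall>A\<in>sets \<nu>. emeasure \<nu> A = (SUP S\<in>{S\<in>sets \<nu>. compact S \<and> S \<subseteq> A}. emeasure \<nu> S))"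

definition L2 :: "'a measure \<Rightarrow> ('a \<Rightarrow> real) set" where
  "L2 \<nu> = {f \<in> borel_measurable \<nu>. integrable \<nu> (\<lambda>\<theta>. (f \<theta>)\<^sup>2)}"

definition L2_inner :: "'a measure \<Rightarrow> ('a \<Rightarrow> real) \<Rightarrow> ('a \<Rightarrow> real) \<Rightarrow> real" where
  "L2_inner \<nu> f g = (\<integral>\<theta>. f \<theta> * g \<theta> \<partial>\<nu>)"

definition L2_norm :: "'a measure \<Rightarrow> ('a \<Rightarrow> real) \<Rightarrow> real" where
  "L2_norm \<nu> f = sqrt (L2_inner \<nu> f f)"

definition L2_nonneg :: "'a measure \<Rightarrow> ('a \<Rightarrow> real) set" where
  "L2_nonneg \<nu> = {f \<in> L2 \<nu>. AE \<theta> in \<nu>. 0 \<le> f \<theta>}"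

text \<open>The Bochner integral of a non-integrable function is 0, so integral 1 entails integrability.\<close>

definition L2_density :: "'a measure \<Rightarrow> ('a \<Rightarrow> real) set" where
  "L2_density \<nu> = {f \<in> L2_nonneg \<nu>. (\<integral>\<theta>. f \<theta> \<partial>\<nu>) = 1}"

definition L2_open :: "'a measure \<Rightarrow> ('a \<Rightarrow> real) set \<Rightarrow> bool" where
  "L2_open \<nu> U \<longleftrightarrow> U \<subseteq> L2 \<nu> \<and>
     (\<forall>f\<in>U. \<exists>e>0. \<forall>g\<in>L2 \<nu>. L2_norm \<nu> (\<lambda>\<theta>. g \<theta> - f \<theta>) < e \<longrightarrow> g \<in> U)"

definition L2_borel :: "'a measure \<Rightarrow> ('a \<Rightarrow> real) measure" where
  "L2_borel \<nu> = sigma (L2 \<nu>) {U. L2_open \<nu> U}"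

definition Pi1 :: "('a \<Rightarrow> nat pmf) \<Rightarrow> nat \<Rightarrow> 'a \<Rightarrow> real" where
  "Pi1 \<pi> k = (\<lambda>\<theta>. pmf (\<pi> \<theta>) k)"

definition L2_independent_seq :: "'a measure \<Rightarrow> (nat \<Rightarrow> 'a \<Rightarrow> real) \<Rightarrow> bool" where
  "L2_independent_seq \<nu> \<phi> \<longleftrightarrow>
     (\<forall>N c. (AE \<theta> in \<nu>. (\<Sum>k<N. c k * \<phi> k \<theta>) = 0) \<longrightarrow> (\<forall>k<N. c k = 0))"

definition V :: "'a measure \<Rightarrow> ('a \<Rightarrow> nat pmf) \<Rightarrow> nat \<Rightarrow> ('a \<Rightarrow> real) set" where
  "V \<nu> \<pi> m = {f \<in> L2 \<nu>. \<exists>c. AE \<theta> in \<nu>. f \<theta> = (\<Sum>k<m. c k * Pi1 \<pi> k \<theta>)}"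

definition L2_ominus :: "'a measure \<Rightarrow> ('a \<Rightarrow> real) set \<Rightarrow> ('a \<Rightarrow> real) set \<Rightarrow> ('a \<Rightarrow> real) set" where
  "L2_ominus \<nu> A B = {f \<in> A. \<forall>g\<in>B. L2_inner \<nu> f g = 0}"

text \<open>
  The orthogonal projection is unique only up to a \<open>\<nu>\<close>-null set, so a representative is chosen.
  It exists for \<open>f \<in> L2 \<nu>\<close> and the finite-dimensional spaces \<open>V \<nu> \<pi> m\<close> spanned by elements of
  \<open>L2 \<nu>\<close>.
\<close>

definition L2_proj :: "'a measure \<Rightarrow> ('a \<Rightarrow> real) set \<Rightarrow> ('a \<Rightarrow> real) \<Rightarrow> 'a \<Rightarrow> real" where
  "L2_proj \<nu> A f = (SOME p. p \<in> A \<and> (\<forall>g\<in>A. L2_inner \<nu> (\<lambda>\<theta>. f \<theta> - p \<theta>) g = 0))"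

definition smooth_class ::
  "'a measure \<Rightarrow> ('a \<Rightarrow> nat pmf) \<Rightarrow> (nat \<Rightarrow> real) \<Rightarrow> real \<Rightarrow> nat \<Rightarrow> ('a \<Rightarrow> real) set" where
  "smooth_class \<nu> \<pi> u C r =
     {f \<in> L2 \<nu>. \<forall>m\<ge>r. L2_norm \<nu> (\<lambda>\<theta>. f \<theta> - L2_proj \<nu> (V \<nu> \<pi> m) f \<theta>) \<le> C * u m}"

text \<open>In \<^typ>\<open>ennreal\<close>, \<open>0 / 0 = 0\<close>, \<open>s / 0 = \<infinity>\<close> for \<open>s > 0\<close>, and \<open>s / \<infinity> = 0\<close> for \<open>s < \<infinity>\<close>.\<close>

definition rel_sup_norm :: "'a measure \<Rightarrow> ('a \<Rightarrow> real) \<Rightarrow> ('a \<Rightarrow> real) \<Rightarrow> ennreal" where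
  "rel_sup_norm \<nu> f0 f = esssup \<nu> (\<lambda>\<theta>. ennreal \<bar>f \<theta>\<bar> / ennreal (f0 \<theta>))"

definition smooth_class_rel ::
  "'a measure \<Rightarrow> ('a \<Rightarrow> nat pmf) \<Rightarrow> ('a \<Rightarrow> real) \<Rightarrow> real \<Rightarrow> (nat \<Rightarrow> real) \<Rightarrow> real \<Rightarrow> nat
     \<Rightarrow> ('a \<Rightarrow> real) set" where
  "smooth_class_rel \<nu> \<pi> f0 K u C r =
     {f \<in> smooth_class \<nu> \<pi> u C r. rel_sup_norm \<nu> f0 f \<le> ennreal K}"

definition K_inf :: "'a measure \<Rightarrow> ('a \<Rightarrow> real) \<Rightarrow> ('a \<Rightarrow> real) set \<Rightarrow> ennreal" where
  "K_inf \<nu> f0 A = (SUP f\<in>{f \<in> A. L2_norm \<nu> f = 1}. rel_sup_norm \<nu> f0 f)"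

text \<open>A probability measure whenever \<open>f \<in> L2_density \<nu>\<close>.\<close>

definition mixture :: "'a measure \<Rightarrow> ('a \<Rightarrow> nat pmf) \<Rightarrow> ('a \<Rightarrow> real) \<Rightarrow> nat measure" where
  "mixture \<nu> \<pi> f =
     density (count_space UNIV) (\<lambda>k. ennreal (\<integral>\<theta>. pmf (\<pi> \<theta>) k * f \<theta> \<partial>\<nu>))"

definition estimators :: "'a measure \<Rightarrow> nat \<Rightarrow> ((nat \<Rightarrow> nat) \<Rightarrow> 'a \<Rightarrow> real) set" where
  "estimators \<nu> n = measurable (PiM {..<n} (\<lambda>_. count_space UNIV)) (L2_borel \<nu>)"

definition risk ::
  "'a measure \<Rightarrow> ('a \<Rightarrow> nat pmf) \<Rightarrow> nat \<Rightarrow> ((nat \<Rightarrow> nat) \<Rightarrow> 'a \<Rightarrow> real) \<Rightarrow> ('a \<Rightarrow> real) \<Rightarrow> ennreal" where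
  "risk \<nu> \<pi> n fhat f =
     (\<integral>\<^sup>+ x. ennreal ((L2_norm \<nu> (\<lambda>\<theta>. fhat x \<theta> - f \<theta>))\<^sup>2) \<partial>PiM {..<n} (\<lambda>_. mixture \<nu> \<pi> f))"

end

theory Submission
  imports Defs
begin

text \<open>
  Two-point argument. A system of \<open>m + 1\<close> homogeneous linear equations in \<open>m + 2\<close> unknowns yields
  a unit vector \<open>g\<close> of \<open>V (m + 2)\<close> orthogonal to \<open>V m\<close> and with integral 0. Let \<open>\<alpha>\<close> be the
  minimum of the two terms in the lower bound. The densities \<open>f0 + \<alpha> g\<close> and \<open>f0 - \<alpha> g\<close> both lie in
  the class, and their mixtures give the same mass as that of \<open>f0\<close> to each \<open>k < m\<close>, since \<open>g\<close> is
  orthogonal to \<open>Pi1 \<pi> k\<close>. On the event that all observations are smaller than \<open>m\<close> the two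
  hypotheses are thus indistinguishable, and the parallelogram law bounds the sum of the two losses
  below by \<open>2 \<alpha>\<^sup>2\<close>.
\<close>

section \<open>Homogeneous linear systems over a field\<close>

text \<open>Gaussian elimination by induction on the number of equations: equation \<open>p\<close>
  serves to eliminate one unknown \<open>k0\<close>, and the remaining system has one equation and
  one unknown fewer.\<close>

lemma underdetermined_system_nontrivial:
  fixes a :: "nat \<Rightarrow> 'i \<Rightarrow> 'f::field"
  assumes "finite I" "p < card I"
  shows "\<exists>c. (\<exists>k\<in>I. c k \<noteq> 0) \<and> (\<forall>i<p. (\<Sum>k\<in>I. a i k * c k) = 0)"
  using assms
proof (induction p arbitrary: I a)
  case 0
  then obtain k where "k \<in> I" by (metis card_gt_0_iff ex_in_conv)
  then show ?case by (intro exI[of _ "\<lambda>_. 1"]) auto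
next
  case (Suc p)
  \<comment> \<open>\<open>k0\<close> is a pivot of equation \<open>p\<close> if there is one.
    Otherwise equation \<open>p\<close> is trivial and \<open>k0\<close> is arbitrary; division by 0
    gives 0, so \<open>b\<close> then agrees with \<open>a\<close> and the formulas below cover both
    cases.\<close>
  obtain k0 where k0: "k0 \<in> I" "(\<forall>k\<in>I. a p k = 0) \<or> a p k0 \<noteq> 0"
    using Suc.prems by (metis card_gt_0_iff ex_in_conv less_trans zero_less_Suc)
  define b where "b i k = a i k - a i k0 * (a p k / a p k0)" for i k
  have "finite (I - {k0})" "p < card (I - {k0})"
    using Suc.prems k0(1) by auto
  then obtain c where c: "\<exists>k\<in>I - {k0}. c k \<noteq> 0"
      "\<And>i. i < p \<Longrightarrow> (\<Sum>k\<in>I - {k0}. b i k * c k) = 0"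
    using Suc.IH[of "I - {k0}" b] by blast
  \<comment> \<open>The value at \<open>k0\<close> is equation \<open>p\<close> solved for that
    unknown.\<close>
  define d where "d = c(k0 := - (\<Sum>k\<in>I - {k0}. a p k / a p k0 * c k))"
  have split: "(\<Sum>k\<in>I. a i k * d k)
      = (\<Sum>k\<in>I - {k0}. a i k * c k) - a i k0 * (\<Sum>k\<in>I - {k0}. a p k / a p k0 * c k)" for i
  proof -
    have "(\<Sum>k\<in>I. a i k * d k) = a i k0 * d k0 + (\<Sum>k\<in>I - {k0}. a i k * d k)"
      using Suc.prems(1) k0(1) by (rule sum.remove)
    also have "(\<Sum>k\<in>I - {k0}. a i k * d k) = (\<Sum>k\<in>I - {k0}. a i k * c k)"
      by (intro sum.cong) (auto simp: d_def)
    finally show ?thesis by (simp add: d_def)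
  qed
  have "(\<Sum>k\<in>I. a i k * d k) = 0" if "i < Suc p" for i
  proof (cases "i = p")
    case True
    show ?thesis
    proof (cases "a p k0 = 0")
      case True
      then show ?thesis using k0(2) \<open>i = p\<close> by simp
    next
      case False
      then show ?thesis
        unfolding split using \<open>i = p\<close> by (simp add: sum_distrib_left)
    qed
  next
    case False
    then have "(\<Sum>k\<in>I - {k0}. b i k * c k) = 0" using that c(2) by simp
    then show ?thesis
      unfolding split
      by (simp add: b_def sum_distrib_left left_diff_distrib sum_subtractf mult.assoc)
  qed
  moreover have "\<exists>k\<in>I. d k \<noteq> 0"
    using c(1) by (auto simp: d_def)
  ultimately show ?case by blast
qed

subsection \<open>Square-integrable functions\<close>

lemma L2_measurable: "f \<in> L2 M \<Longrightarrow> f \<in> borel_measurable M"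
  by (simp add: L2_def)

text \<open>The product is dominated by the sum of the two squares. Additivity of
  \<open>L2_inner\<close> rests on this, since the Bochner integral is additive only on integrable
  functions.\<close>

lemma L2_integrable_mult:
  assumes "f \<in> L2 M" "g \<in> L2 M"
  shows "integrable M (\<lambda>x. f x * g x)"
proof (rule Bochner_Integration.integrable_bound)
  have [measurable]: "f \<in> borel_measurable M" "g \<in> borel_measurable M"
    and int: "integrable M (\<lambda>x. (f x)\<^sup>2)" "integrable M (\<lambda>x. (g x)\<^sup>2)"
    using assms unfolding L2_def by blast+
  from int show "integrable M (\<lambda>x. (f x)\<^sup>2 + (g x)\<^sup>2)"
    by (rule Bochner_Integration.integrable_add)
  show "(\<lambda>x. f x * g x) \<in> borel_measurable M"
    by measurable
  have "\<bar>a * b\<bar> \<le> a\<^sup>2 + b\<^sup>2" for a b :: real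
    using sum_squares_bound[of "\<bar>a\<bar>" "\<bar>b\<bar>"] abs_ge_zero[of "a * b"]
    unfolding abs_mult power2_abs by linarith
  then show "AE x in M. norm (f x * g x) \<le> norm ((f x)\<^sup>2 + (g x)\<^sup>2)"
    by simp
qed

lemma L2_add: "f \<in> L2 M \<Longrightarrow> g \<in> L2 M \<Longrightarrow> (\<lambda>x. f x + g x) \<in> L2 M"
  using L2_integrable_mult[of f M g] by (auto simp: L2_def power2_sum mult.assoc)

lemma L2_scale: "f \<in> L2 M \<Longrightarrow> (\<lambda>x. c * f x) \<in> L2 M"
  by (auto simp: L2_def power_mult_distrib)

lemma L2_diff: "f \<in> L2 M \<Longrightarrow> g \<in> L2 M \<Longrightarrow> (\<lambda>x. f x - g x) \<in> L2 M"
  using L2_add[OF _ L2_scale[of g M "-1"]] by simp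

lemma L2_zero: "(\<lambda>x. 0) \<in> L2 M"
  by (simp add: L2_def)

lemma L2_sum: "finite I \<Longrightarrow> (\<And>i. i \<in> I \<Longrightarrow> f i \<in> L2 M) \<Longrightarrow> (\<lambda>x. \<Sum>i\<in>I. f i x) \<in> L2 M"
  by (induction I rule: finite_induct) (auto intro: L2_zero L2_add)

lemma L2_inner_commute: "L2_inner M f g = L2_inner M g f"
  by (simp add: L2_inner_def mult.commute)

lemma L2_inner_scale_left: "L2_inner M (\<lambda>x. c * f x) g = c * L2_inner M f g"
  by (simp add: L2_inner_def mult.assoc)

lemma L2_inner_scale_right: "L2_inner M f (\<lambda>x. c * g x) = c * L2_inner M f g"
  by (metis L2_inner_commute L2_inner_scale_left)

lemma L2_inner_add_left:
  "f \<in> L2 M \<Longrightarrow> g \<in> L2 M \<Longrightarrow> h \<in> L2 M \<Longrightarrow>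
    L2_inner M (\<lambda>x. f x + g x) h = L2_inner M f h + L2_inner M g h"
  by (simp add: L2_inner_def distrib_right L2_integrable_mult)

lemma L2_inner_add_right:
  "f \<in> L2 M \<Longrightarrow> g \<in> L2 M \<Longrightarrow> h \<in> L2 M \<Longrightarrow>
    L2_inner M h (\<lambda>x. f x + g x) = L2_inner M h f + L2_inner M h g"
  using L2_inner_add_left[of f M g h] by (simp add: L2_inner_commute)

lemma L2_inner_diff_left:
  "f \<in> L2 M \<Longrightarrow> g \<in> L2 M \<Longrightarrow> h \<in> L2 M \<Longrightarrow>
    L2_inner M (\<lambda>x. f x - g x) h = L2_inner M f h - L2_inner M g h"
  by (simp add: L2_inner_def left_diff_distrib L2_integrable_mult)

lemma L2_inner_diff_right:
  "f \<in> L2 M \<Longrightarrow> g \<in> L2 M \<Longrightarrow> h \<in> L2 M \<Longrightarrow>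
    L2_inner M h (\<lambda>x. f x - g x) = L2_inner M h f - L2_inner M h g"
  using L2_inner_diff_left[of f M g h] by (simp add: L2_inner_commute)

lemma L2_inner_sum_right:
  "finite I \<Longrightarrow> (\<And>i. i \<in> I \<Longrightarrow> g i \<in> L2 M) \<Longrightarrow> f \<in> L2 M \<Longrightarrow>
    L2_inner M f (\<lambda>x. \<Sum>i\<in>I. c i * g i x) = (\<Sum>i\<in>I. c i * L2_inner M f (g i))"
proof (induction I rule: finite_induct)
  case (insert i I)
  then show ?case
    by (simp add: L2_inner_add_right L2_inner_scale_right L2_scale L2_sum)
qed (simp add: L2_inner_def)

lemma L2_inner_cong_AE:
  assumes "AE x in M. g x = g' x" "f \<in> L2 M" "g \<in> L2 M" "g' \<in> L2 M"
  shows "L2_inner M f g = L2_inner M f g'"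
  unfolding L2_inner_def
  by (rule integral_cong_AE) (use assms in \<open>auto simp: L2_def\<close>)

lemma L2_inner_self_nonneg: "0 \<le> L2_inner M f f"
  by (simp add: L2_inner_def)

lemma L2_norm_power2: "(L2_norm M f)\<^sup>2 = L2_inner M f f"
  by (simp add: L2_norm_def L2_inner_self_nonneg)

lemma L2_norm_nonneg: "0 \<le> L2_norm M f"
  by (simp add: L2_norm_def L2_inner_self_nonneg)

lemma L2_norm_scale: "L2_norm M (\<lambda>x. c * f x) = \<bar>c\<bar> * L2_norm M f"
  by (simp add: L2_norm_def L2_inner_scale_left L2_inner_scale_right real_sqrt_mult
      flip: mult.assoc)

lemma L2_inner_self_eq_0_AE:
  assumes "f \<in> L2 M" "L2_inner M f f = 0"
  shows "AE x in M. f x = 0"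
proof -
  have "AE x in M. f x * f x = 0"
    using assms integral_nonneg_eq_0_iff_AE[OF L2_integrable_mult[OF assms(1,1)]]
    by (simp add: L2_inner_def)
  then show ?thesis by simp
qed

text \<open>This is the parallelogram law for \<open>y = x - f\<close> and \<open>h\<close>. The
  term in \<open>h\<close> on the right does not depend on \<open>x\<close>, so it bounds the total
  loss of any estimate \<open>x\<close> from below.\<close>

lemma L2_parallelogram:
  assumes "x \<in> L2 M" "f \<in> L2 M" "h \<in> L2 M"
  shows "(L2_norm M (\<lambda>\<theta>. x \<theta> - (f \<theta> + h \<theta>)))\<^sup>2 + (L2_norm M (\<lambda>\<theta>. x \<theta> - (f \<theta> - h \<theta>)))\<^sup>2
    = 2 * (L2_norm M (\<lambda>\<theta>. x \<theta> - f \<theta>))\<^sup>2 + 2 * (L2_norm M h)\<^sup>2"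
proof -
  define y where "y = (\<lambda>\<theta>. x \<theta> - f \<theta>)"
  have y: "y \<in> L2 M" unfolding y_def using assms by (intro L2_diff)
  have "(L2_norm M (\<lambda>\<theta>. y \<theta> - h \<theta>))\<^sup>2 + (L2_norm M (\<lambda>\<theta>. y \<theta> + h \<theta>))\<^sup>2
      = 2 * (L2_norm M y)\<^sup>2 + 2 * (L2_norm M h)\<^sup>2"
    using y assms(3)
    by (simp add: L2_norm_power2 L2_inner_add_left L2_inner_add_right L2_inner_diff_left
        L2_inner_diff_right L2_add L2_diff)
  moreover have "(\<lambda>\<theta>. x \<theta> - (f \<theta> + h \<theta>)) = (\<lambda>\<theta>. y \<theta> - h \<theta>)"
    "(\<lambda>\<theta>. x \<theta> - (f \<theta> - h \<theta>)) = (\<lambda>\<theta>. y \<theta> + h \<theta>)"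
    by (auto simp: y_def)
  ultimately show ?thesis
    by (simp only: y_def)
qed

subsection \<open>The spaces V and orthogonal projection\<close>

lemma V_subset_L2: "V M \<pi> m \<subseteq> L2 M"
  by (auto simp: V_def)

lemma V_zero: "(\<lambda>x. 0) \<in> V M \<pi> m"
  by (auto simp: V_def L2_zero intro!: exI[of _ "\<lambda>_. 0"])

lemma V_add:
  assumes "f \<in> V M \<pi> m" "g \<in> V M \<pi> m"
  shows "(\<lambda>x. f x + g x) \<in> V M \<pi> m"
proof -
  from assms obtain a b where
    "AE x in M. f x = (\<Sum>k<m. a k * Pi1 \<pi> k x)" "AE x in M. g x = (\<Sum>k<m. b k * Pi1 \<pi> k x)"
    by (auto simp: V_def)
  then have "AE x in M. f x + g x = (\<Sum>k<m. (a k + b k) * Pi1 \<pi> k x)"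
    by eventually_elim (simp add: distrib_right sum.distrib)
  then show ?thesis using assms by (auto simp: V_def intro: L2_add)
qed

lemma V_scale:
  assumes "f \<in> V M \<pi> m"
  shows "(\<lambda>x. c * f x) \<in> V M \<pi> m"
proof -
  from assms obtain a where "AE x in M. f x = (\<Sum>k<m. a k * Pi1 \<pi> k x)"
    by (auto simp: V_def)
  then have "AE x in M. c * f x = (\<Sum>k<m. (c * a k) * Pi1 \<pi> k x)"
    by eventually_elim (simp add: sum_distrib_left mult.assoc)
  then show ?thesis
    using assms by (auto simp: V_def intro: L2_scale)
qed

lemma V_diff: "f \<in> V M \<pi> m \<Longrightarrow> g \<in> V M \<pi> m \<Longrightarrow> (\<lambda>x. f x - g x) \<in> V M \<pi> m"
  using V_add[OF _ V_scale[of g M \<pi> m "-1"]] by simp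

lemma V_mono:
  assumes "m \<le> m'"
  shows "V M \<pi> m \<subseteq> V M \<pi> m'"
proof
  fix f assume f: "f \<in> V M \<pi> m"
  then obtain a where a: "AE x in M. f x = (\<Sum>k<m. a k * Pi1 \<pi> k x)"
    by (auto simp: V_def)
  have "(\<Sum>k<m'. (if k < m then a k else 0) * Pi1 \<pi> k x) = (\<Sum>k<m. a k * Pi1 \<pi> k x)" for x
    using assms by (intro sum.mono_neutral_cong_right) auto
  with a f show "f \<in> V M \<pi> m'"
    by (auto simp: V_def intro!: exI[of _ "\<lambda>k. if k < m then a k else 0"])
qed

lemma Pi1_in_V: "Pi1 \<pi> k \<in> L2 M \<Longrightarrow> Pi1 \<pi> k \<in> V M \<pi> (Suc k)"
  by (auto simp: V_def intro!: exI[of _ "\<lambda>j. if j = k then 1 else 0"])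

lemma orthogonal_V_iff:
  assumes "\<And>k. Pi1 \<pi> k \<in> L2 M" "f \<in> L2 M"
  shows "(\<forall>g\<in>V M \<pi> m. L2_inner M f g = 0) \<longleftrightarrow> (\<forall>k<m. L2_inner M f (Pi1 \<pi> k) = 0)"
proof (intro iffI ballI allI impI)
  fix k assume "\<forall>g\<in>V M \<pi> m. L2_inner M f g = 0" "k < m"
  then show "L2_inner M f (Pi1 \<pi> k) = 0"
    using Pi1_in_V[OF assms(1)] V_mono[of "Suc k" m] by (metis Suc_leI subsetD)
next
  fix g assume *: "\<forall>k<m. L2_inner M f (Pi1 \<pi> k) = 0" and g: "g \<in> V M \<pi> m"
  from g obtain a where a: "AE x in M. g x = (\<Sum>k<m. a k * Pi1 \<pi> k x)"
    by (auto simp: V_def)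
  \<comment> \<open>\<open>g\<close> is a combination of the generators only almost everywhere;
    linearity applies once it is replaced by an actual finite sum.\<close>
  have "L2_inner M f g = L2_inner M f (\<lambda>x. \<Sum>k<m. a k * Pi1 \<pi> k x)"
    using a assms subsetD[OF V_subset_L2 g] by (intro L2_inner_cong_AE) (auto intro!: L2_sum L2_scale)
  also have "\<dots> = (\<Sum>k<m. a k * L2_inner M f (Pi1 \<pi> k))"
    using assms by (intro L2_inner_sum_right) auto
  finally show "L2_inner M f g = 0" using * by simp
qed

text \<open>One Gram-Schmidt step per dimension.\<close>

lemma L2_proj_exists:
  assumes "\<And>k. Pi1 \<pi> k \<in> L2 M" "f \<in> L2 M"
  shows "\<exists>p\<in>V M \<pi> m. \<forall>g\<in>V M \<pi> m. L2_inner M (\<lambda>x. f x - p x) g = 0"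
  using assms(2)
proof (induction m arbitrary: f)
  case 0
  then show ?case
    using orthogonal_V_iff[OF assms(1), of f 0] by (intro bexI[OF _ V_zero]) auto
next
  case (Suc m)
  obtain p where p: "p \<in> V M \<pi> m" "\<forall>g\<in>V M \<pi> m. L2_inner M (\<lambda>x. f x - p x) g = 0"
    using Suc by blast
  obtain q where q: "q \<in> V M \<pi> m" "\<forall>g\<in>V M \<pi> m. L2_inner M (\<lambda>x. Pi1 \<pi> m x - q x) g = 0"
    using Suc.IH[OF assms(1)] by blast
  define e where "e = (\<lambda>x. Pi1 \<pi> m x - q x)"
  have pq: "p \<in> L2 M" "q \<in> L2 M" "e \<in> L2 M"
    using p(1) q(1) V_subset_L2 assms(1) by (auto simp: e_def intro!: L2_diff)
  have eV: "e \<in> V M \<pi> (Suc m)"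
    unfolding e_def using q(1) V_mono[of m "Suc m"] assms(1)
    by (intro V_diff Pi1_in_V) auto
  \<comment> \<open>\<open>s\<close> is the coefficient of the projection of \<open>f\<close> onto
    \<open>e\<close>, the part of \<open>Pi1 \<pi> m\<close> orthogonal to
    \<open>V M \<pi> m\<close>. If \<open>e\<close> is null, then \<open>s\<close> is 0 by division
    by 0, and \<open>L2_inner M f e\<close> vanishes too.\<close>
  define s where "s = L2_inner M f e / L2_inner M e e"
  define p' where "p' = (\<lambda>x. p x + s * e x)"
  have p'V: "p' \<in> V M \<pi> (Suc m)"
    unfolding p'_def using p(1) V_mono[of m "Suc m"] eV by (intro V_add V_scale) auto
  then have p'L2: "p' \<in> L2 M" using V_subset_L2 by blast
  have res: "L2_inner M (\<lambda>x. f x - p' x) g = L2_inner M (\<lambda>x. f x - p x) g - s * L2_inner M e g"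
    if "g \<in> L2 M" for g
    using that Suc.prems pq
    by (simp add: p'_def L2_inner_diff_left L2_inner_add_left L2_inner_scale_left L2_add L2_scale)
  have below: "L2_inner M (\<lambda>x. f x - p' x) g = 0" if "g \<in> V M \<pi> m" for g
    using that p(2) q(2) res[of g] V_subset_L2[of M \<pi> m] by (auto simp: e_def)
  have "L2_inner M f e - s * L2_inner M e e = 0"
  proof (cases "L2_inner M e e = 0")
    case True
    then have "L2_inner M f e = L2_inner M f (\<lambda>x. 0)"
      using L2_inner_self_eq_0_AE pq(3) Suc.prems by (intro L2_inner_cong_AE L2_zero) auto
    then show ?thesis using True by (simp add: L2_inner_def)
  qed (simp add: s_def)
  moreover have "L2_inner M p e = 0"
    using q(2) p(1) by (simp add: L2_inner_commute e_def)
  ultimately have "L2_inner M (\<lambda>x. f x - p' x) e = 0"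
    using pq Suc.prems by (simp add: res L2_inner_diff_left)
  \<comment> \<open>Since \<open>Pi1 \<pi> m = e + q\<close> with \<open>q\<close> in
    \<open>V M \<pi> m\<close>, orthogonality to \<open>e\<close> and to \<open>V M \<pi> m\<close>
    gives orthogonality to the new generator.\<close>
  moreover have "L2_inner M (\<lambda>x. f x - p' x) e
      = L2_inner M (\<lambda>x. f x - p' x) (Pi1 \<pi> m) - L2_inner M (\<lambda>x. f x - p' x) q"
    unfolding e_def using Suc.prems p'L2 pq assms(1) by (intro L2_inner_diff_right L2_diff) auto
  ultimately have "L2_inner M (\<lambda>x. f x - p' x) (Pi1 \<pi> m) = 0"
    using below q(1) by simp
  moreover have "L2_inner M (\<lambda>x. f x - p' x) (Pi1 \<pi> k) = 0" if "k < m" for k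
    using that below Pi1_in_V[OF assms(1)] V_mono[of "Suc k" m] by (metis Suc_leI subsetD)
  ultimately have "\<forall>k<Suc m. L2_inner M (\<lambda>x. f x - p' x) (Pi1 \<pi> k) = 0"
    by (auto simp: less_Suc_eq)
  then show ?case
    using p'V Suc.prems p'L2 assms(1) by (intro bexI[of _ p']) (auto simp: orthogonal_V_iff L2_diff)
qed

text \<open>\<open>L2_proj\<close> is a choice by \<open>SOME\<close>, so existence of a projection
  is what gives it its defining properties.\<close>

lemma L2_proj_V:
  assumes "\<And>k. Pi1 \<pi> k \<in> L2 M" "f \<in> L2 M"
  shows "L2_proj M (V M \<pi> m) f \<in> V M \<pi> m"
    and "g \<in> V M \<pi> m \<Longrightarrow> L2_inner M (\<lambda>x. f x - L2_proj M (V M \<pi> m) f x) g = 0"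
proof -
  have "\<exists>p. p \<in> V M \<pi> m \<and> (\<forall>g\<in>V M \<pi> m. L2_inner M (\<lambda>x. f x - p x) g = 0)"
    using L2_proj_exists[OF assms] by blast
  from someI_ex[OF this]
  show "L2_proj M (V M \<pi> m) f \<in> V M \<pi> m"
    and "g \<in> V M \<pi> m \<Longrightarrow> L2_inner M (\<lambda>x. f x - L2_proj M (V M \<pi> m) f x) g = 0"
    by (auto simp: L2_proj_def)
qed

text \<open>Pythagoras: the residual is orthogonal to the projection, so its squared norm is that of
  \<open>f\<close> minus that of the projection.\<close>

lemma L2_norm_residual_le:
  assumes "\<And>k. Pi1 \<pi> k \<in> L2 M" "f \<in> L2 M"
  shows "L2_norm M (\<lambda>x. f x - L2_proj M (V M \<pi> m) f x) \<le> L2_norm M f"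
proof -
  define p where "p = L2_proj M (V M \<pi> m) f"
  have p: "p \<in> V M \<pi> m" "L2_inner M (\<lambda>x. f x - p x) p = 0"
    using L2_proj_V[OF assms] by (auto simp: p_def)
  then have pL2: "p \<in> L2 M" using V_subset_L2 by blast
  have "L2_inner M (\<lambda>x. f x - p x) (\<lambda>x. f x - p x) = L2_inner M f f - L2_inner M p p"
    using p(2) pL2 assms(2)
    by (simp add: L2_inner_diff_left L2_inner_diff_right L2_diff L2_inner_commute[of M p f])
  then show ?thesis
    using L2_inner_self_nonneg[of M p] by (simp add: L2_norm_def p_def)
qed

text \<open>The residual lies in \<open>V M \<pi> m\<close> and is orthogonal to that space, hence
  to itself.\<close>

lemma L2_norm_residual_eq_0:
  assumes "\<And>k. Pi1 \<pi> k \<in> L2 M" "f \<in> V M \<pi> m"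
  shows "L2_norm M (\<lambda>x. f x - L2_proj M (V M \<pi> m) f x) = 0"
proof -
  have "f \<in> L2 M" using assms(2) V_subset_L2 by blast
  from L2_proj_V[OF assms(1) this, where m = m] V_diff[OF assms(2)] show ?thesis
    by (simp add: L2_norm_def)
qed

text \<open>One norm bound settles all the conditions of the class. For \<open>j \<le> l\<close> the
  residual is at most the norm of \<open>h\<close>, and \<open>u l \<le> u j\<close>; for
  \<open>j > l\<close> the function lies in \<open>V M \<pi> j\<close> and the residual
  vanishes.\<close>

lemma V_in_smooth_class:
  assumes "\<And>k. Pi1 \<pi> k \<in> L2 M" "h \<in> V M \<pi> (Suc l)" "L2_norm M h \<le> C * u l"
    and "\<And>j. 0 \<le> u j" "decseq u" "0 \<le> C"
  shows "h \<in> smooth_class M \<pi> u C r"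
proof -
  have hL2: "h \<in> L2 M" using assms(2) V_subset_L2 by blast
  have "L2_norm M (\<lambda>x. h x - L2_proj M (V M \<pi> j) h x) \<le> C * u j" for j
  proof (cases "j \<le> l")
    case True
    then have "C * u l \<le> C * u j"
      using assms(5,6) by (intro mult_left_mono) (auto simp: decseq_def)
    then show ?thesis
      using L2_norm_residual_le[OF assms(1) hL2, of j] assms(3) by linarith
  next
    case False
    then have "h \<in> V M \<pi> j" using assms(2) V_mono[of "Suc l" j M \<pi>] by auto
    then show ?thesis
      using L2_norm_residual_eq_0[OF assms(1)] assms(4,6) by simp
  qed
  then show ?thesis using hL2 by (simp add: smooth_class_def)
qed

text \<open>Orthogonality to \<open>V M \<pi> m\<close> costs \<open>m\<close> equations and the
  zero integral one more, which is why the space has index \<open>m + 2\<close>. Linear independence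
  ensures that nontrivial coefficients give a function that is not almost everywhere 0 and can be
  normalized.\<close>

lemma exists_unit_direction:
  assumes "\<And>k. Pi1 \<pi> k \<in> L2 M" "\<And>k. integrable M (Pi1 \<pi> k)" "L2_independent_seq M (Pi1 \<pi>)"
  obtains g where "g \<in> L2_ominus M (V M \<pi> (m + 2)) (V M \<pi> m)" "L2_norm M g = 1"
    "integrable M g" "(\<integral>x. g x \<partial>M) = 0"
proof -
  \<comment> \<open>Rows below \<open>m\<close> express orthogonality to the generators of
    \<open>V M \<pi> m\<close>; row \<open>m\<close> expresses the zero integral.\<close>
  define a where "a i k = (if i < m then L2_inner M (Pi1 \<pi> i) (Pi1 \<pi> k) else \<integral>x. Pi1 \<pi> k x \<partial>M)"
    for i k
  obtain c where c: "\<exists>k<m+2. c k \<noteq> 0" "\<And>i. i < Suc m \<Longrightarrow> (\<Sum>k<m+2. a i k * c k) = 0"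
    using underdetermined_system_nontrivial[of "{..<m+2}" "Suc m" a] by auto
  define h where "h = (\<lambda>x. \<Sum>k<m+2. c k * Pi1 \<pi> k x)"
  have hL2: "h \<in> L2 M"
    unfolding h_def using assms(1) by (intro L2_sum L2_scale) auto
  then have hV: "h \<in> V M \<pi> (m + 2)"
    by (auto simp: V_def h_def)
  have "L2_inner M h (Pi1 \<pi> i) = 0" if "i < m" for i
  proof -
    have "L2_inner M (Pi1 \<pi> i) h = (\<Sum>k<m+2. c k * L2_inner M (Pi1 \<pi> i) (Pi1 \<pi> k))"
      unfolding h_def using assms(1) by (intro L2_inner_sum_right) auto
    also have "\<dots> = (\<Sum>k<m+2. a i k * c k)"
      using that by (intro sum.cong) (auto simp: a_def)
    finally show ?thesis using c(2)[of i] that by (simp add: L2_inner_commute)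
  qed
  then have horth: "\<forall>g\<in>V M \<pi> m. L2_inner M h g = 0"
    using orthogonal_V_iff[OF assms(1) hL2] by blast
  have hint: "integrable M h"
    unfolding h_def using assms(2) by auto
  have "(\<integral>x. h x \<partial>M) = (\<Sum>k<m+2. c k * (\<integral>x. Pi1 \<pi> k x \<partial>M))"
    unfolding h_def using assms(2) by (subst Bochner_Integration.integral_sum) auto
  also have "\<dots> = (\<Sum>k<m+2. a m k * c k)"
    by (intro sum.cong) (auto simp: a_def)
  finally have h0: "(\<integral>x. h x \<partial>M) = 0" using c(2)[of m] by simp
  have nz: "L2_norm M h \<noteq> 0"
  proof
    assume "L2_norm M h = 0"
    then have "AE x in M. h x = 0"
      using L2_inner_self_eq_0_AE[OF hL2] L2_norm_power2[of M h] by simp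
    then show False
      using assms(3) c(1) unfolding L2_independent_seq_def h_def by blast
  qed
  define g where "g = (\<lambda>x. inverse (L2_norm M h) * h x)"
  show thesis
  proof
    show "g \<in> L2_ominus M (V M \<pi> (m + 2)) (V M \<pi> m)"
      using hV horth by (auto simp: L2_ominus_def g_def L2_inner_scale_left intro!: V_scale)
    show "L2_norm M g = 1"
      using nz by (simp add: g_def L2_norm_scale L2_norm_nonneg)
    show "integrable M g" "(\<integral>x. g x \<partial>M) = 0"
      using hint h0 by (auto simp: g_def)
  qed
qed

subsection \<open>The relative supremum norm\<close>

lemma rel_sup_norm_scale_le:
  assumes [measurable]: "f0 \<in> borel_measurable M" "g \<in> borel_measurable M"
  shows "rel_sup_norm M f0 (\<lambda>x. t * g x) \<le> ennreal \<bar>t\<bar> * rel_sup_norm M f0 g"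
  unfolding rel_sup_norm_def
proof (rule esssup_I)
  have "AE x in M. ennreal \<bar>g x\<bar> / ennreal (f0 x)
      \<le> esssup M (\<lambda>\<theta>. ennreal \<bar>g \<theta>\<bar> / ennreal (f0 \<theta>))"
    by (rule esssup_AE)
  then show "AE x in M. ennreal \<bar>t * g x\<bar> / ennreal (f0 x)
      \<le> ennreal \<bar>t\<bar> * esssup M (\<lambda>\<theta>. ennreal \<bar>g \<theta>\<bar> / ennreal (f0 \<theta>))"
    by eventually_elim
      (auto simp: abs_mult ennreal_mult ennreal_times_divide[symmetric] intro!: mult_left_mono)
qed measurable

text \<open>For \<open>K \<le> 1\<close> this pointwise bound keeps \<open>f0 + h\<close>
  nonnegative almost everywhere.\<close>

lemma abs_le_of_rel_sup_norm_le:
  assumes "rel_sup_norm M f0 h \<le> ennreal K" "AE x in M. 0 \<le> f0 x" "0 \<le> K"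
  shows "AE x in M. \<bar>h x\<bar> \<le> K * f0 x"
proof -
  have "AE x in M. ennreal \<bar>h x\<bar> / ennreal (f0 x)
      \<le> esssup M (\<lambda>\<theta>. ennreal \<bar>h \<theta>\<bar> / ennreal (f0 \<theta>))"
    by (rule esssup_AE)
  then show ?thesis
    using assms(2)
  proof eventually_elim
    case (elim x)
    then have le: "ennreal \<bar>h x\<bar> / ennreal (f0 x) \<le> ennreal K"
      using assms(1) by (simp add: rel_sup_norm_def)
    show ?case
    proof (cases "f0 x = 0")
      case True
      \<comment> \<open>A nonzero value divided by 0 is infinite and would exceed the finite
        \<open>K\<close>.\<close>
      then have "h x = 0"
        using le by (cases "h x = 0") (auto simp: top_unique)
      then show ?thesis using True by simp
    next
      case False
      then have "ennreal (\<bar>h x\<bar> / f0 x) \<le> ennreal K"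
        using le elim(2) by (simp add: divide_ennreal)
      then show ?thesis
        using False elim(2) assms(3) by (simp add: field_simps)
    qed
  qed
qed

lemma rel_sup_norm_le_K_inf:
  "g \<in> A \<Longrightarrow> L2_norm M g = 1 \<Longrightarrow> rel_sup_norm M f0 g \<le> K_inf M f0 A"
  unfolding K_inf_def by (intro SUP_upper) auto

text \<open>An inequality rather than an equation: for \<open>y = 0\<close> and for
  \<open>y = \<top>\<close> the product collapses to 0. It is applied to \<open>K_inf\<close>, which
  may be infinite.\<close>

lemma ennreal_divide_mult_le:
  fixes x y :: ennreal
  assumes "x \<noteq> \<top>"
  shows "(x / y) * y \<le> x"
  using assms by (cases "y = 0 \<or> y = \<top>") (auto simp: ennreal_divide_times less_top)

subsection \<open>Samples from mixtures\<close>

text \<open>The density takes values \<open>ennreal\<close> of a real, hence finite ones, for every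
  \<open>f\<close>. This admits the product measure rules without first showing that the mixture is
  a probability measure.\<close>

lemma sigma_finite_mixture: "sigma_finite_measure (mixture M \<pi> f)"
proof -
  interpret sigma_finite_measure "count_space (UNIV :: nat set)"
    by (rule sigma_finite_measure_count_space)
  show ?thesis
    unfolding mixture_def by (subst sigma_finite_iff_density_finite) auto
qed

lemma sets_mixture: "sets (mixture M \<pi> f) = UNIV"
  by (simp add: mixture_def)

lemma emeasure_mixture_singleton:
  "emeasure (mixture M \<pi> f) {k} = ennreal (L2_inner M (Pi1 \<pi> k) f)"
  by (simp add: mixture_def emeasure_density L2_inner_def Pi1_def nn_integral_count_space_indicator[symmetric])

lemma product_sigma_finite_mixture: "product_sigma_finite (\<lambda>_. mixture M \<pi> f)"
  by (simp add: product_sigma_finite_def sigma_finite_mixture)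

lemma finite_sample_box: "finite (PiE {..<n} (\<lambda>_. {..<m::nat}))" for n :: nat
  by (intro finite_PiE) auto

text \<open>A sample is fixed outside \<open>{..<n}\<close> by extensionality, so a single sample is
  a product of singletons and its probability a product of point masses.\<close>

lemma sample_singleton:
  fixes n :: nat
  assumes "x \<in> PiE {..<n} B"
  shows "{x} = PiE {..<n} (\<lambda>i. {x i})"
  using assms by (simp add: PiE_singleton PiE_iff)

lemma sample_singleton_sets:
  fixes n :: nat
  assumes "x \<in> PiE {..<n} B"
  shows "{x} \<in> sets (PiM {..<n} (\<lambda>_. mixture M \<pi> f))"
  unfolding sample_singleton[OF assms] by (intro sets_PiM_I_finite) (auto simp: sets_mixture)

lemma emeasure_sample_singleton:
  fixes n :: nat
  assumes "x \<in> PiE {..<n} B"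
  shows "emeasure (PiM {..<n} (\<lambda>_. mixture M \<pi> f)) {x} = (\<Prod>i<n. emeasure (mixture M \<pi> f) {x i})"
proof -
  interpret product_sigma_finite "\<lambda>_. mixture M \<pi> f"
    by (rule product_sigma_finite_mixture)
  show ?thesis
    unfolding sample_singleton[OF assms] by (intro emeasure_PiM) (auto simp: sets_mixture)
qed

text \<open>Both sides are the probability that all \<open>n\<close> observations are below
  \<open>m\<close>: once summed over the finitely many samples, once as the measure of a product
  set.\<close>

lemma sum_sample_box:
  "(\<Sum>x\<in>PiE {..<n} (\<lambda>_. {..<m}). \<Prod>i<n. emeasure (mixture M \<pi> f) {x i})
    = emeasure (mixture M \<pi> f) {..<m} ^ n"
proof -
  interpret product_sigma_finite "\<lambda>_. mixture M \<pi> f"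
    by (rule product_sigma_finite_mixture)
  have "(\<Sum>x\<in>PiE {..<n} (\<lambda>_. {..<m}). \<Prod>i<n. emeasure (mixture M \<pi> f) {x i})
      = (\<Sum>x\<in>PiE {..<n} (\<lambda>_. {..<m}). emeasure (PiM {..<n} (\<lambda>_. mixture M \<pi> f)) {x})"
    by (intro sum.cong refl emeasure_sample_singleton[symmetric])
  also have "\<dots> = emeasure (PiM {..<n} (\<lambda>_. mixture M \<pi> f)) (PiE {..<n} (\<lambda>_. {..<m}))"
    by (intro emeasure_eq_sum_singleton[symmetric] finite_sample_box sample_singleton_sets)
  also have "\<dots> = (\<Prod>i<n. emeasure (mixture M \<pi> f) {..<m})"
    by (intro emeasure_PiM) (auto simp: sets_mixture)
  finally show ?thesis by simp
qed

text \<open>Samples outside the finite box are discarded; over the box the integral is a sum over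
  points.\<close>

lemma risk_ge_sum_sample_box:
  "(\<Sum>x\<in>PiE {..<n} (\<lambda>_. {..<m}). ennreal ((L2_norm M (\<lambda>\<theta>. fhat x \<theta> - f \<theta>))\<^sup>2)
      * (\<Prod>i<n. emeasure (mixture M \<pi> f) {x i})) \<le> risk M \<pi> n fhat f"
proof -
  let ?B = "PiE {..<n} (\<lambda>_. {..<m})" and ?P = "PiM {..<n} (\<lambda>_. mixture M \<pi> f)"
  let ?loss = "\<lambda>x. ennreal ((L2_norm M (\<lambda>\<theta>. fhat x \<theta> - f \<theta>))\<^sup>2)"
  have "(\<Sum>x\<in>?B. ?loss x * (\<Prod>i<n. emeasure (mixture M \<pi> f) {x i}))
      = (\<Sum>x\<in>?B. ?loss x * emeasure ?P {x})"
    by (intro sum.cong refl arg_cong2[where f="(*)"] emeasure_sample_singleton[symmetric])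
  also have "\<dots> = (\<integral>\<^sup>+x. ?loss x * indicator ?B x \<partial>?P)"
    by (intro nn_integral_indicator_finite[symmetric] finite_sample_box sample_singleton_sets)
  also have "\<dots> \<le> (\<integral>\<^sup>+x. ?loss x \<partial>?P)"
    by (intro nn_integral_mono) (auto simp: indicator_def)
  finally show ?thesis by (simp add: risk_def)
qed

section \<open>Comparison of two hypotheses\<close>

text \<open>The comparison is made sample by sample over the box, where \<open>f\<close>,
  \<open>f + h\<close> and \<open>f - h\<close> give the same weight. The factor 2 is kept on the
  left so that no halving in \<open>ennreal\<close> is called for.\<close>

lemma two_point_risk_bound:
  assumes "f \<in> L2 M" "h \<in> L2 M" "\<And>k. Pi1 \<pi> k \<in> L2 M"
    and "\<And>k. k < m \<Longrightarrow> L2_inner M (Pi1 \<pi> k) h = 0"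
    and "\<And>x. x \<in> PiE {..<n} (\<lambda>_. UNIV) \<Longrightarrow> fhat x \<in> L2 M"
  shows "2 * (ennreal ((L2_norm M h)\<^sup>2) * emeasure (mixture M \<pi> f) {..<m} ^ n)
    \<le> risk M \<pi> n fhat (\<lambda>x. f x + h x) + risk M \<pi> n fhat (\<lambda>x. f x - h x)"
proof -
  let ?B = "PiE {..<n} (\<lambda>_. {..<m})"
  let ?loss = "\<lambda>f x. ennreal ((L2_norm M (\<lambda>\<theta>. fhat x \<theta> - f \<theta>))\<^sup>2)"
  define fp fm where "fp = (\<lambda>x. f x + h x)" and "fm = (\<lambda>x. f x - h x)"
  define w where "w x = (\<Prod>i<n. emeasure (mixture M \<pi> f) {x i})" for x
  \<comment> \<open>A point mass depends on the mixing function only through its inner product with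
    \<open>Pi1 \<pi> k\<close>, and all coordinates of \<open>x\<close> are below \<open>m\<close>,
    where \<open>h\<close> contributes 0.\<close>
  have w: "w x = (\<Prod>i<n. emeasure (mixture M \<pi> fp) {x i})"
          "w x = (\<Prod>i<n. emeasure (mixture M \<pi> fm) {x i})" if "x \<in> ?B" for x
    unfolding w_def using that assms
    by (auto intro!: prod.cong simp: emeasure_mixture_singleton fp_def fm_def
        L2_inner_add_right L2_inner_diff_right PiE_iff)
  have loss: "2 * ennreal ((L2_norm M h)\<^sup>2) \<le> ?loss fp x + ?loss fm x" if "x \<in> ?B" for x
  proof -
    have "fhat x \<in> L2 M" using that by (intro assms(5)) (auto simp: PiE_iff)
    from L2_parallelogram[OF this assms(1,2)]
    have "2 * (L2_norm M h)\<^sup>2 \<le> (L2_norm M (\<lambda>\<theta>. fhat x \<theta> - fp \<theta>))\<^sup>2 + (L2_norm M (\<lambda>\<theta>. fhat x \<theta> - fm \<theta>))\<^sup>2"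
      by (simp add: fp_def fm_def)
    then have "ennreal (2 * (L2_norm M h)\<^sup>2)
        \<le> ennreal ((L2_norm M (\<lambda>\<theta>. fhat x \<theta> - fp \<theta>))\<^sup>2 + (L2_norm M (\<lambda>\<theta>. fhat x \<theta> - fm \<theta>))\<^sup>2)"
      by (rule ennreal_leI)
    then show ?thesis by (simp add: ennreal_mult)
  qed
  have "2 * (ennreal ((L2_norm M h)\<^sup>2) * emeasure (mixture M \<pi> f) {..<m} ^ n)
      = (\<Sum>x\<in>?B. 2 * ennreal ((L2_norm M h)\<^sup>2) * w x)"
    unfolding sum_sample_box[symmetric] w_def by (simp add: sum_distrib_left mult.assoc)
  also have "\<dots> \<le> (\<Sum>x\<in>?B. (?loss fp x + ?loss fm x) * w x)"
    by (intro sum_mono mult_right_mono loss) auto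
  also have "\<dots> = (\<Sum>x\<in>?B. ?loss fp x * w x) + (\<Sum>x\<in>?B. ?loss fm x * w x)"
    by (simp add: distrib_right sum.distrib)
  also have "(\<Sum>x\<in>?B. ?loss fp x * w x)
      = (\<Sum>x\<in>?B. ?loss fp x * (\<Prod>i<n. emeasure (mixture M \<pi> fp) {x i}))"
    by (intro sum.cong) (auto simp: w(1))
  also have "(\<Sum>x\<in>?B. ?loss fm x * w x)
      = (\<Sum>x\<in>?B. ?loss fm x * (\<Prod>i<n. emeasure (mixture M \<pi> fm) {x i}))"
    by (intro sum.cong) (auto simp: w(2))
  also have "(\<Sum>x\<in>?B. ?loss fp x * (\<Prod>i<n. emeasure (mixture M \<pi> fp) {x i}))
      + (\<Sum>x\<in>?B. ?loss fm x * (\<Prod>i<n. emeasure (mixture M \<pi> fm) {x i}))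
      \<le> risk M \<pi> n fhat fp + risk M \<pi> n fhat fm"
    by (intro add_mono risk_ge_sum_sample_box)
  finally show ?thesis by (simp add: fp_def fm_def)
qed

text \<open>A measurable map sends the space of its source into that of its target, here
  \<open>L2 M\<close>, as the parallelogram law requires of \<open>fhat x\<close>.\<close>

lemma estimators_in_L2:
  assumes "fhat \<in> estimators M n" "x \<in> PiE {..<n} (\<lambda>_. UNIV)"
  shows "fhat x \<in> L2 M"
proof -
  have "space (L2_borel M) = L2 M"
    unfolding L2_borel_def by (rule space_measure_of) (auto simp: L2_open_def)
  then show ?thesis
    using assms measurable_space[of fhat _ "L2_borel M" x] by (auto simp: estimators_def space_PiM)
qed

section \<open>Two densities of the class at distance \<open>\<alpha>\<close> from
  \<open>f0\<close>, and the resulting lower bound\<close>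

theorem theorem1:
  fixes \<Theta> :: "(real ^ 'd) set"
    and \<nu> :: "(real ^ 'd) measure"
    and \<pi> :: "real ^ 'd \<Rightarrow> nat pmf"
    and f0 :: "real ^ 'd \<Rightarrow> real"
    and u :: "nat \<Rightarrow> real"
    and C K :: real
    and r n m :: nat
    and fhat :: "(nat \<Rightarrow> nat) \<Rightarrow> real ^ 'd \<Rightarrow> real"
  assumes "\<Theta> \<in> sets borel"
    and "radon_measure_on \<Theta> \<nu>"
    and "\<And>k. (\<lambda>\<theta>. pmf (\<pi> \<theta>) k) \<in> borel_measurable (restrict_space borel \<Theta>)"
    and "f0 \<in> L2_density \<nu>"
    and "\<And>j. u j > 0" and "decseq u"
    and "C > 0"
    and "0 < K" and "K \<le> 1"
    and "\<And>k. Pi1 \<pi> k \<in> L2 \<nu>" and "\<And>k. integrable \<nu> (Pi1 \<pi> k)"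
    and "L2_independent_seq \<nu> (Pi1 \<pi>)"
    and "n > 0"
    and "fhat \<in> estimators \<nu> n"
    and "m \<ge> r"
  shows "(SUP f \<in> (\<lambda>g \<theta>. f0 \<theta> + g \<theta>) ` smooth_class_rel \<nu> \<pi> f0 K u C r \<inter> L2_density \<nu>.
            risk \<nu> \<pi> n fhat f)
         \<ge> (min (ennreal K / K_inf \<nu> f0 (L2_ominus \<nu> (V \<nu> \<pi> (m + 2)) (V \<nu> \<pi> m)))
                (ennreal (C * u (m + 1))))\<^sup>2
           * (emeasure (mixture \<nu> \<pi> f0) {..<m}) ^ n"
proof -
  let ?W = "L2_ominus \<nu> (V \<nu> \<pi> (m + 2)) (V \<nu> \<pi> m)"
  let ?F = "(\<lambda>g \<theta>. f0 \<theta> + g \<theta>) ` smooth_class_rel \<nu> \<pi> f0 K u C r \<inter> L2_density \<nu>"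
  let ?S = "SUP f \<in> ?F. risk \<nu> \<pi> n fhat f"
  note Pi_L2 = assms(10)
  define a where "a = min (ennreal K / K_inf \<nu> f0 ?W) (ennreal (C * u (m + 1)))"
  \<comment> \<open>The second term of the minimum is finite, so \<open>a\<close> is a real number
    \<open>\<alpha>\<close>; it is 0 when \<open>K_inf\<close> is infinite.\<close>
  have "a \<noteq> \<top>" unfolding a_def by (auto simp: min_def top_unique)
  then obtain \<alpha> where \<alpha>: "a = ennreal \<alpha>" "0 \<le> \<alpha>"
    by (cases a) auto
  have "ennreal \<alpha> \<le> ennreal (C * u (m + 1))"
    unfolding \<alpha>(1)[symmetric] by (simp add: a_def)
  then have \<alpha>_u: "\<alpha> \<le> C * u (m + 1)"
    using assms(5)[of "m + 1"] assms(7) by simp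
  have "a * K_inf \<nu> f0 ?W \<le> (ennreal K / K_inf \<nu> f0 ?W) * K_inf \<nu> f0 ?W"
    by (intro mult_right_mono) (auto simp: a_def)
  also have "\<dots> \<le> ennreal K"
    by (rule ennreal_divide_mult_le) simp
  finally have \<alpha>_K: "ennreal \<alpha> * K_inf \<nu> f0 ?W \<le> ennreal K"
    by (simp add: \<alpha>(1))
  have f0: "f0 \<in> L2 \<nu>" "AE \<theta> in \<nu>. 0 \<le> f0 \<theta>" "(\<integral>\<theta>. f0 \<theta> \<partial>\<nu>) = 1"
    using assms(4) by (auto simp: L2_density_def L2_nonneg_def)
  \<comment> \<open>A non-integrable function has Bochner integral 0, not 1.\<close>
  then have f0_int: "integrable \<nu> f0"
    using not_integrable_integral_eq by fastforce
  obtain g where g: "g \<in> ?W" "L2_norm \<nu> g = 1" "integrable \<nu> g" "(\<integral>\<theta>. g \<theta> \<partial>\<nu>) = 0"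
    using exists_unit_direction[OF assms(10-12)] .
  have gV: "g \<in> V \<nu> \<pi> (m + 2)" and gL2: "g \<in> L2 \<nu>"
    using g(1) V_subset_L2 by (auto simp: L2_ominus_def)
  have g_orth: "L2_inner \<nu> (Pi1 \<pi> k) g = 0" if "k < m" for k
    using g(1) that orthogonal_V_iff[OF Pi_L2 gL2, of m]
    by (auto simp: L2_ominus_def L2_inner_commute[of \<nu> "Pi1 \<pi> k"])
  \<comment> \<open>Both hypotheses are treated at once, as \<open>t = \<alpha>\<close> and
    \<open>t = -\<alpha>\<close>.\<close>
  have member: "(\<lambda>\<theta>. f0 \<theta> + t * g \<theta>) \<in> ?F" if t: "\<bar>t\<bar> = \<alpha>" for t
  proof -
    have "(\<lambda>\<theta>. t * g \<theta>) \<in> smooth_class \<nu> \<pi> u C r"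
      \<comment> \<open>With \<open>l = m + 1\<close> the space \<open>V \<nu> \<pi> (Suc l)\<close>
        is the one containing \<open>g\<close>, and the bound to meet is
        \<open>C * u (m + 1)\<close>.\<close>
      using V_scale[OF gV] \<alpha>_u t g(2) assms(5-7)
      by (intro V_in_smooth_class[OF Pi_L2, where l = "m + 1"])
         (auto simp: L2_norm_scale less_imp_le)
    moreover have sup: "rel_sup_norm \<nu> f0 (\<lambda>\<theta>. t * g \<theta>) \<le> ennreal K"
    proof -
      have "rel_sup_norm \<nu> f0 (\<lambda>\<theta>. t * g \<theta>) \<le> ennreal \<bar>t\<bar> * rel_sup_norm \<nu> f0 g"
        using f0(1) gL2 by (intro rel_sup_norm_scale_le L2_measurable)
      also have "\<dots> \<le> ennreal \<alpha> * K_inf \<nu> f0 ?W"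
        unfolding t by (intro mult_left_mono rel_sup_norm_le_K_inf g) auto
      finally show ?thesis using \<alpha>_K by simp
    qed
    ultimately have "(\<lambda>\<theta>. t * g \<theta>) \<in> smooth_class_rel \<nu> \<pi> f0 K u C r"
      by (simp add: smooth_class_rel_def)
    moreover have "(\<lambda>\<theta>. f0 \<theta> + t * g \<theta>) \<in> L2_density \<nu>"
    proof -
      have "AE \<theta> in \<nu>. \<bar>t * g \<theta>\<bar> \<le> K * f0 \<theta>"
        using assms(8) by (intro abs_le_of_rel_sup_norm_le[OF sup f0(2)]) simp
      \<comment> \<open>As \<open>K \<le> 1\<close>, the perturbation is at most \<open>f0\<close>
        in absolute value.\<close>
      with f0(2) have "AE \<theta> in \<nu>. 0 \<le> f0 \<theta> + t * g \<theta>"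
      proof eventually_elim
        case (elim \<theta>)
        then have "K * f0 \<theta> \<le> 1 * f0 \<theta>" using assms(9) by (intro mult_right_mono)
        with elim show ?case by linarith
      qed
      moreover have "(\<integral>\<theta>. f0 \<theta> + t * g \<theta> \<partial>\<nu>) = 1"
        using f0_int g f0(3) by simp
      ultimately show ?thesis
        using L2_add[OF f0(1) L2_scale[OF gL2]] by (simp add: L2_density_def L2_nonneg_def)
    qed
    ultimately show ?thesis by (intro IntI image_eqI[OF refl])
  qed
  define h where "h = (\<lambda>\<theta>. \<alpha> * g \<theta>)"
  have h: "h \<in> L2 \<nu>" "L2_norm \<nu> h = \<alpha>"
    using gL2 g(2) \<alpha>(2) by (auto simp: h_def L2_scale L2_norm_scale)
  have "2 * (ennreal ((L2_norm \<nu> h)\<^sup>2) * emeasure (mixture \<nu> \<pi> f0) {..<m} ^ n)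
      \<le> risk \<nu> \<pi> n fhat (\<lambda>\<theta>. f0 \<theta> + h \<theta>) + risk \<nu> \<pi> n fhat (\<lambda>\<theta>. f0 \<theta> - h \<theta>)"
    using g_orth estimators_in_L2[OF assms(14)]
    by (intro two_point_risk_bound f0(1) h Pi_L2) (auto simp: h_def L2_inner_scale_right)
  also have "\<dots> \<le> ?S + ?S"
    using member[of \<alpha>] member[of "-\<alpha>"] \<alpha>(2)
    by (intro add_mono SUP_upper) (auto simp: h_def)
  finally have "2 * (ennreal (\<alpha>\<^sup>2) * emeasure (mixture \<nu> \<pi> f0) {..<m} ^ n) \<le> 2 * ?S"
    by (simp add: h mult_2)
  \<comment> \<open>The factor 2 cancels in \<open>ennreal\<close> because it is neither 0 nor
    infinite.\<close>
  then have "ennreal (\<alpha>\<^sup>2) * emeasure (mixture \<nu> \<pi> f0) {..<m} ^ n \<le> ?S"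
    by (subst (asm) ennreal_mult_le_mult_iff) auto
  then show ?thesis
    unfolding a_def[symmetric] using \<alpha> by (simp add: ennreal_power)
qed

end
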